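(* Let $(\bar x,\bar y)\in\operatorname{gph}Y$. Suppose that $f$ is semidifferentiable at $(\bar x,\bar y)$, and that the set-valued mapping $Y$ is semidifferentiable at $\bar x$ for $\bar y$ and calm around $(\bar x,\bar y)$. Then there exists $\kappa>0$ such that the value function $$V_\tau(x):=\max_{y'\in Y(x)\cap\mathbb{B}_{\tau(\|x-\bar x\|)}(\bar y)}f(x,y')\qquad\text{with }\tau(\delta):=\kappa\delta$$ is semidifferentiable (and thus directionally differentiable) at $\bar x$, and for any $u\in\mathbb{R}^n$, $$V_\tau'(\bar x;u)=\max_{h\in DY(\bar x,\bar y)(u)}{\rm d}f(\bar x,\bar y)(u,h).$$
   Context: Setting: $f:\mathbb{R}^n\times\mathbb{R}^m\to\mathbb{R}$ (possibly nonsmooth), $X\subseteq\mathbb{R}^n$ nonempty closed, $Y:\mathbb{R}^n\rightrightarrows\mathbb{R}^m$ a set-valued map with $Y(x)$ nonempty and closed for each $x\in X$; for each $x\in X$ the solution set of $\max_{y'\in Y(x)}f(x,y')$ is nonempty. $\operatorname{gph}Y=\{(x,y)\mid y\in Y(x)\}$; $\mathbb{B}_r(z)$ is the closed Euclidean ball of radius $r$ centred at $z$; $\mathbb{B}$ is the closed unit ball. Standing assumption: for the radius function $\tau$ considered there is $\delta_0>0$ with $Y(x)\cap\mathbb{B}_{\tau(\delta)}(\bar y)\ne\emptyset$ for all $\delta\in(0,\delta_0]$, $x\in X\cap\mathbb{B}_\delta(\bar x)$. Graphical derivative: $h\in DY(\bar x,\bar y)(u)\iff(u,h)\in T_{\operatorname{gph}Y}(\bar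 x,\bar y)$, where $T_S(\bar z)=\{w\mid\exists t_k\downarrow0,w_k\to w,\bar z+t_kw_k\in S\}$. $Y$ is semidifferentiable at $\bar x$ for $\bar y$ if for every $u\in\mathbb{R}^n$ the Painlevé–Kuratowski limit $\lim_{t\downarrow0,u'\to u}\frac{Y(\bar x+tu')-\bar y}{t}$ exists (outer and inner limits agree). $Y$ is calm around $(\bar x,\bar y)$ if there are $l>0$ and neighborhoods $U$ of $\bar x$, $V$ of $\bar y$ with $Y(x)\cap V\subseteq\bar y+l\|x-\bar x\|\mathbb{B}$ for all $x\in U$. For a function $\psi$ finite at $\bar z$: ${\rm d}\psi(\bar z)(w)=\liminf_{t\downarrow0,w'\to w}\frac{\psi(\bar z+tw')-\psi(\bar z)}{t}$; $\psi$ is semidifferentiable at $\bar z$ if for every $w$ this liminf is a full limit. $\psi'(\bar z;w)=\lim_{t\downarrow0}\frac{\psi(\bar z+tw)-\psi(\bar z)}{t}$ is the directional derivative. *)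

theory Defs
  imports "HOL-Analysis.Analysis"
begin

section \<open>Set-valued mappings\<close>

definition gph :: "('a \<Rightarrow> 'b set) \<Rightarrow> ('a \<times> 'b) set" where
  "gph Y = {(x, y). y \<in> Y x}"

definition tangent_cone :: "'a::real_normed_vector set \<Rightarrow> 'a \<Rightarrow> 'a set" where
  "tangent_cone S z =
     {w. \<exists>(t :: nat \<Rightarrow> real) (v :: nat \<Rightarrow> 'a).
           (\<forall>k. 0 < t k) \<and> t \<longlonglongrightarrow> 0 \<and> v \<longlonglongrightarrow> w \<and> (\<forall>k. z + t k *\<^sub>R v k \<in> S)}"

definition graphical_derivative ::
    "('a::real_normed_vector \<Rightarrow> 'b::real_normed_vector set) \<Rightarrow> 'a \<Rightarrow> 'b \<Rightarrow> 'a \<Rightarrow> 'b set" where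
  "graphical_derivative Y x y u = {h. (u, h) \<in> tangent_cone (gph Y) (x, y)}"

text \<open>Painleve-Kuratowski outer and inner limits of a set-valued mapping along a filter, in
  sequential form.  In the inner limit the selection has to exist only from some index on, so
  that finitely many empty values do no harm.\<close>

definition outer_limit :: "'p filter \<Rightarrow> ('p \<Rightarrow> 'b::topological_space set) \<Rightarrow> 'b set" where
  "outer_limit F S =
     {h. \<exists>(p :: nat \<Rightarrow> 'p) (g :: nat \<Rightarrow> 'b).
           filterlim p F sequentially \<and> g \<longlonglongrightarrow> h \<and> (\<forall>k. g k \<in> S (p k))}"

definition inner_limit :: "'p filter \<Rightarrow> ('p \<Rightarrow> 'b::topological_space set) \<Rightarrow> 'b set" where
  "inner_limit F S =
     {h. \<forall>p :: nat \<Rightarrow> 'p. filterlim p F sequentially \<longrightarrow>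
           (\<exists>g :: nat \<Rightarrow> 'b. g \<longlonglongrightarrow> h \<and> (\<forall>\<^sub>F k in sequentially. g k \<in> S (p k)))}"

text \<open>The filter of \<open>t \<down> 0, w' \<rightarrow> w\<close>; the value \<open>w' = w\<close> is allowed, \<open>t = 0\<close> is not.\<close>

definition semi_filter :: "'a::topological_space \<Rightarrow> (real \<times> 'a) filter" where
  "semi_filter w = at_right 0 \<times>\<^sub>F nhds w"

definition set_semidifferentiable ::
    "('a::real_normed_vector \<Rightarrow> 'b::real_normed_vector set) \<Rightarrow> 'a \<Rightarrow> 'b \<Rightarrow> bool" where
  "set_semidifferentiable Y x y \<longleftrightarrow>
     (\<forall>u. let Q = (\<lambda>(t, u'). (\<lambda>z. (z - y) /\<^sub>R t) ` Y (x + t *\<^sub>R u'))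
          in outer_limit (semi_filter u) Q = inner_limit (semi_filter u) Q)"

definition calm_around ::
    "('a::real_normed_vector \<Rightarrow> 'b::real_normed_vector set) \<Rightarrow> 'a \<Rightarrow> 'b \<Rightarrow> bool" where
  "calm_around Y x y \<longleftrightarrow>
     (\<exists>l>0. \<exists>U V. open U \<and> x \<in> U \<and> open V \<and> y \<in> V \<and>
        (\<forall>x'\<in>U. Y x' \<inter> V \<subseteq> cball y (l * norm (x' - x))))"


section \<open>Extended-real-valued functions\<close>

definition diff_quot :: "('a::real_normed_vector \<Rightarrow> ereal) \<Rightarrow> 'a \<Rightarrow> real \<Rightarrow> 'a \<Rightarrow> ereal" where
  "diff_quot \<psi> z t w = (\<psi> (z + t *\<^sub>R w) - \<psi> z) / ereal t"

definition subderivative :: "('a::real_normed_vector \<Rightarrow> ereal) \<Rightarrow> 'a \<Rightarrow> 'a \<Rightarrow> ereal" where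
  "subderivative \<psi> z w = Liminf (semi_filter w) (\<lambda>(t, w'). diff_quot \<psi> z t w')"

text \<open>The limits may be infinite a priori.  The requirement at \<open>w = 0\<close> forces \<open>\<psi>\<close> to be calm,
  hence finite, near \<open>z\<close>, and then all limits are finite.\<close>

definition semidifferentiable :: "('a::real_normed_vector \<Rightarrow> ereal) \<Rightarrow> 'a \<Rightarrow> bool" where
  "semidifferentiable \<psi> z \<longleftrightarrow>
     \<bar>\<psi> z\<bar> \<noteq> \<infinity> \<and>
     (\<forall>w. ((\<lambda>(t, w'). diff_quot \<psi> z t w') \<longlongrightarrow> subderivative \<psi> z w) (semi_filter w))"

definition directionally_differentiable :: "('a::real_normed_vector \<Rightarrow> ereal) \<Rightarrow> 'a \<Rightarrow> bool" where
  "directionally_differentiable \<psi> z \<longleftrightarrow>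
     \<bar>\<psi> z\<bar> \<noteq> \<infinity> \<and>
     (\<forall>w. \<exists>d::real. ((\<lambda>t. diff_quot \<psi> z t w) \<longlongrightarrow> ereal d) (at_right 0))"

text \<open>Meaningful only where the limit exists.\<close>

definition dir_deriv :: "('a::real_normed_vector \<Rightarrow> ereal) \<Rightarrow> 'a \<Rightarrow> 'a \<Rightarrow> ereal" where
  "dir_deriv \<psi> z w = Lim (at_right 0) (\<lambda>t. diff_quot \<psi> z t w)"

definition is_maximum :: "'a::order \<Rightarrow> 'a set \<Rightarrow> bool" where
  "is_maximum m A \<longleftrightarrow> m \<in> A \<and> (\<forall>a\<in>A. a \<le> m)"


section \<open>The localized value function\<close>

definition admissible_radius ::
    "'a::real_normed_vector set \<Rightarrow> ('a \<Rightarrow> 'b::real_normed_vector set) \<Rightarrow> 'a \<Rightarrow> 'b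
      \<Rightarrow> (real \<Rightarrow> real) \<Rightarrow> bool" where
  "admissible_radius X Y xb yb \<tau> \<longleftrightarrow>
     (\<exists>\<delta>0>0. \<forall>\<delta>\<in>{0<..\<delta>0}. \<forall>x\<in>X \<inter> cball xb \<delta>. Y x \<inter> cball yb (\<tau> \<delta>) \<noteq> {})"

text \<open>The maximum is the supremum in the extended reals, so it is \<open>-\<infinity>\<close> over an empty feasible
  set (possible away from the reference point).  No continuity of \<open>f\<close> away from the reference point is
  assumed, so the supremum over the localized feasible set need not be attained.\<close>

definition local_value ::
    "('a::real_normed_vector \<times> 'b::real_normed_vector \<Rightarrow> real) \<Rightarrow> ('a \<Rightarrow> 'b set) \<Rightarrow> 'a \<Rightarrow> 'b
      \<Rightarrow> (real \<Rightarrow> real) \<Rightarrow> 'a \<Rightarrow> ereal" where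
  "local_value f Y xb yb \<tau> x =
     (SUP y' \<in> Y x \<inter> cball yb (\<tau> (norm (x - xb))). ereal (f (x, y')))"

end

theory Submission
  imports Defs
begin

text \<open>
  The radius constant \<open>\<kappa>\<close> is a calmness modulus of \<open>Y\<close>. With this choice, a point \<open>y'\<close> of \<open>Y x'\<close>
  close to the reference value \<open>y\<close> automatically satisfies the localizing constraint
  \<open>\<parallel>y' - y\<parallel> \<le> \<kappa> \<parallel>x' - x\<parallel>\<close> once \<open>x'\<close> is close to \<open>x\<close>, and conversely that constraint bounds the slope
  \<open>(y' - y) / t\<close> of every feasible \<open>y'\<close> when \<open>x' = x + t u'\<close>. The value at the reference point is
  \<open>f (x, y)\<close>, the radius there being zero.

  The feasible sets near \<open>x\<close> are nonempty (\<open>localized_values_nonempty\<close>): \<open>0\<close> lies in the graphical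
  derivative at direction \<open>0\<close>, hence in the inner limit of the slopes, and the inner limit
  produces points of \<open>Y x'\<close> converging to \<open>y\<close> along every \<open>x' \<rightarrow> x\<close>.

  For the limit of the difference quotients of the value function, take any \<open>t\<^sub>k \<down> 0\<close> and
  \<open>u\<^sub>k \<rightarrow> u\<close>, and points \<open>y\<^sub>k\<close> that maximize up to an error \<open>t\<^sub>k\<^sup>2\<close>, so that they change
  the quotient by at most \<open>t\<^sub>k\<close>. Their slopes are bounded, so a subsequence of them converges to some \<open>h\<close>, which lies in
  the graphical derivative at \<open>u\<close>, and by semidifferentiability of \<open>f\<close> the quotients
  converge along it to \<open>df(u, h)\<close>. Every competitor \<open>h'\<close> in the graphical
  derivative is the limit of slopes of feasible points along the same subsequence, because outer and
  inner limits agree, and so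
  \<open>df(u, h') \<le> df(u, h)\<close>. Thus every subsequential limit is the maximum of \<open>df(u, \<sqdot>)\<close>
  (\<open>local_value_quotient_subsequence\<close>). This shows at once that the maximum is attained and that the
  full limit exists (\<open>local_value_quotient_limit\<close>).
\<close>

section \<open>Sequences along the filter of semidifferentiation\<close>

lemma semi_filter_le_at_within: "semi_filter u \<le> at (0, u) within ({0<..} \<times> UNIV)"
proof (rule filter_leI)
  fix P :: "real \<times> 'a \<Rightarrow> bool"
  assume "eventually P (at (0, u) within ({0<..} \<times> UNIV))"
  then obtain Pf Pg where Pf: "eventually Pf (nhds 0)" and Pg: "eventually Pg (nhds u)"
    and P: "\<And>t v. Pf t \<Longrightarrow> Pg v \<Longrightarrow> 0 < t \<Longrightarrow> P (t, v)"
    by (auto simp: eventually_at_filter nhds_prod eventually_prod_filter)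
  have "eventually (\<lambda>t. Pf t \<and> 0 < t) (at_right 0)"
    using Pf by (auto simp: eventually_at_filter elim: eventually_mono)
  with Pg P show "eventually P (semi_filter u)"
    unfolding semi_filter_def eventually_prod_filter by blast
qed

lemma semi_filter_neq_bot: "semi_filter u \<noteq> bot"
  by (simp add: semi_filter_def prod_filter_eq_bot nhds_neq_bot)

lemma filterlim_semi_filter:
  assumes "eventually (\<lambda>k. 0 < t k) F" "(t \<longlongrightarrow> 0) F" "(v \<longlongrightarrow> u) F"
  shows "filterlim (\<lambda>k. (t k, v k)) (semi_filter u) F"
  unfolding semi_filter_def
  by (rule filterlim_Pair) (use assms in \<open>auto simp: filterlim_at elim: eventually_mono\<close>)

text \<open>Sequences suffice because the filter lies below a punctured neighbourhood filter of the
  first-countable product space.\<close>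
lemma tendsto_semi_filter_sequentiallyI:
  fixes u :: "'a::first_countable_topology"
  assumes "\<And>t v. (\<And>k. 0 < t k) \<Longrightarrow> t \<longlonglongrightarrow> 0 \<Longrightarrow> v \<longlonglongrightarrow> u \<Longrightarrow> (\<lambda>k. F (t k, v k)) \<longlonglongrightarrow> l"
  shows "(F \<longlongrightarrow> l) (semi_filter u)"
proof (rule tendsto_mono[OF semi_filter_le_at_within])
  show "(F \<longlongrightarrow> l) (at (0, u) within ({0<..} \<times> UNIV))"
    unfolding tendsto_at_iff_sequentially
  proof (intro allI impI)
    fix p :: "nat \<Rightarrow> real \<times> 'a"
    assume p: "\<forall>i. p i \<in> {0<..} \<times> UNIV - {(0, u)}" "p \<longlonglongrightarrow> (0, u)"
    have "(\<lambda>k. F (fst (p k), snd (p k))) \<longlonglongrightarrow> l"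
    proof (rule assms)
      show "0 < fst (p k)" for k using p(1) by (auto simp: mem_Times_iff)
      show "(\<lambda>k. fst (p k)) \<longlonglongrightarrow> 0" "(\<lambda>k. snd (p k)) \<longlonglongrightarrow> u"
        using tendsto_fst[OF p(2)] tendsto_snd[OF p(2)] by simp_all
    qed
    then show "(F \<circ> p) \<longlonglongrightarrow> l" by (simp add: comp_def)
  qed
qed

section \<open>Semidifferentiable real functions\<close>
lemma diff_quot_real:
  "0 < t \<Longrightarrow> diff_quot (\<lambda>z. ereal (f z)) z t w = ereal ((f (z + t *\<^sub>R w) - f z) / t)"
  by (simp add: diff_quot_def)

lemma semidifferentiable_sequentially:
  assumes "semidifferentiable \<psi> z" "eventually (\<lambda>k. 0 < t k) sequentially" "t \<longlonglongrightarrow> 0" "v \<longlonglongrightarrow> w"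
  shows "(\<lambda>k. diff_quot \<psi> z (t k) (v k)) \<longlonglongrightarrow> subderivative \<psi> z w"
  using filterlim_compose[OF _ filterlim_semi_filter[OF assms(2-4)]] assms(1)
  unfolding semidifferentiable_def by fastforce

text \<open>In the direction \<open>0\<close> the limit must be \<open>0\<close>, as the constant direction shows; so the quotients
  are below \<open>1\<close> in absolute value for small \<open>t\<close> and small directions. Writing an increment \<open>v\<close>
  as \<open>t\<close> times a direction of fixed small norm turns this into a bound linear in \<open>v\<close>.\<close>
lemma semidifferentiable_imp_calm:
  fixes f :: "'a::real_normed_vector \<Rightarrow> real"
  assumes "semidifferentiable (\<lambda>z. ereal (f z)) z"
  obtains L \<epsilon> where "0 < \<epsilon>" "0 < L" "\<And>v. norm v < \<epsilon> \<Longrightarrow> \<bar>f (z + v) - f z\<bar> \<le> L * norm v"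
proof -
  let ?D = "\<lambda>(t, w'). diff_quot (\<lambda>z. ereal (f z)) z t w'"
  have lim: "(?D \<longlongrightarrow> subderivative (\<lambda>z. ereal (f z)) z 0) (semi_filter 0)"
    using assms by (simp add: semidifferentiable_def)
  have "(\<lambda>k. diff_quot (\<lambda>z. ereal (f z)) z (inverse (real (Suc k))) 0)
          \<longlonglongrightarrow> subderivative (\<lambda>z. ereal (f z)) z 0"
    by (rule semidifferentiable_sequentially[OF assms]) (use LIMSEQ_inverse_real_of_nat in auto)
  then have "subderivative (\<lambda>z. ereal (f z)) z 0 = 0"
    by (simp add: diff_quot_def LIMSEQ_const_iff)
  with lim have "eventually (\<lambda>p. ?D p \<in> {-1<..<1}) (semi_filter 0)"
    by (intro topological_tendstoD[where l = 0]) auto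
  then obtain Pf Pg where Pf: "eventually Pf (at_right 0)" and Pg: "eventually Pg (nhds 0)"
    and P: "\<And>t v. Pf t \<Longrightarrow> Pg v \<Longrightarrow> ?D (t, v) \<in> {-1<..<1}"
    unfolding semi_filter_def eventually_prod_filter by blast
  obtain b where b: "0 < b" "\<And>t. 0 < t \<Longrightarrow> t < b \<Longrightarrow> Pf t"
    using Pf by (auto simp: eventually_at_right_field)
  obtain r where r: "0 < r" "\<And>v. norm v < r \<Longrightarrow> Pg v"
    using Pg by (auto simp: eventually_nhds_metric dist_norm)
  show ?thesis
  proof
    show "0 < b * r / 2" "0 < 2 / r" using b r by simp_all
    fix v :: 'a assume v: "norm v < b * r / 2"
    show "\<bar>f (z + v) - f z\<bar> \<le> 2 / r * norm v"
    proof (cases "v = 0")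
      case False
      \<comment> \<open>The scale at which \<open>v / t\<close> has norm \<open>r / 2\<close>.\<close>
      define t where "t = 2 / r * norm v"
      have t: "0 < t" "t < b"
        using False v r by (auto simp: t_def field_simps)
      have "norm (v /\<^sub>R t) < r" using False r(1) by (simp add: t_def field_simps)
      then have "?D (t, v /\<^sub>R t) \<in> {-1<..<1}" using P b r t by blast
      then have "ereal (-1) < ereal ((f (z + v) - f z) / t)" "ereal ((f (z + v) - f z) / t) < ereal 1"
        using t by (simp_all add: diff_quot_real one_ereal_def)
      then have "- t < f (z + v) - f z" "f (z + v) - f z < t"
        using t(1) by (simp_all add: field_simps)
      then show ?thesis by (simp add: t_def)
    qed simp
  qed
qed


text \<open>Calmness bounds the quotients along a fixed direction, so the limits, a priori extended reals,
  are finite; this lets the rest of the argument work with real sequences.\<close>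
lemma semidifferentiable_subderivative_real:
  fixes f :: "'a::real_normed_vector \<Rightarrow> real"
  assumes "semidifferentiable (\<lambda>z. ereal (f z)) z"
  shows "\<exists>d. \<forall>w. subderivative (\<lambda>z. ereal (f z)) z w = ereal (d w)"
proof -
  obtain L \<epsilon> where L: "0 < \<epsilon>" "0 < L" "\<And>v. norm v < \<epsilon> \<Longrightarrow> \<bar>f (z + v) - f z\<bar> \<le> L * norm v"
    using semidifferentiable_imp_calm[OF assms] by metis
  have "\<bar>subderivative (\<lambda>z. ereal (f z)) z w\<bar> \<noteq> \<infinity>" for w
  proof -
    define t where "t k = inverse (real (Suc k))" for k
    have t: "0 < t k" "t \<longlonglongrightarrow> 0" for k
      unfolding t_def using LIMSEQ_inverse_real_of_nat by auto
    have lim: "(\<lambda>k. diff_quot (\<lambda>z. ereal (f z)) z (t k) w) \<longlonglongrightarrow> subderivative (\<lambda>z. ereal (f z)) z w"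
      by (rule semidifferentiable_sequentially[OF assms]) (use t in auto)
    have "(\<lambda>k. norm (t k *\<^sub>R w)) \<longlonglongrightarrow> 0"
      by (rule tendsto_norm_zero) (use tendsto_scaleR[OF t(2) tendsto_const] in simp)
    then have "eventually (\<lambda>k. norm (t k *\<^sub>R w) < \<epsilon>) sequentially"
      by (rule order_tendstoD) (use L in simp)
    then have "eventually (\<lambda>k. \<bar>(f (z + t k *\<^sub>R w) - f z) / t k\<bar> \<le> L * norm w) sequentially"
    proof (rule eventually_mono)
      fix k assume "norm (t k *\<^sub>R w) < \<epsilon>"
      from L(3)[OF this] t(1)[of k] show "\<bar>(f (z + t k *\<^sub>R w) - f z) / t k\<bar> \<le> L * norm w"
        by (simp add: field_simps)
    qed
    then have ev: "\<forall>\<^sub>F k in sequentially. - ereal (L * norm w) \<le> diff_quot (\<lambda>z. ereal (f z)) z (t k) w \<and>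
        diff_quot (\<lambda>z. ereal (f z)) z (t k) w \<le> ereal (L * norm w)"
    proof eventually_elim
      case (elim k)
      then show ?case unfolding diff_quot_real[OF t(1)] abs_le_iff by simp
    qed
    have "subderivative (\<lambda>z. ereal (f z)) z w \<le> ereal (L * norm w)"
      by (rule tendsto_upperbound[OF lim]) (use ev in \<open>auto elim: eventually_mono\<close>)
    moreover have "- ereal (L * norm w) \<le> subderivative (\<lambda>z. ereal (f z)) z w"
      by (rule tendsto_lowerbound[OF lim]) (use ev in \<open>auto elim: eventually_mono\<close>)
    ultimately show ?thesis by auto
  qed
  then show ?thesis
    by (intro exI[of _ "\<lambda>w. real_of_ereal (subderivative (\<lambda>z. ereal (f z)) z w)"]) (simp add: ereal_real)
qed

lemma semidifferentiable_real_sequentially: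
  fixes f :: "'a::real_normed_vector \<Rightarrow> real"
  assumes "semidifferentiable (\<lambda>z. ereal (f z)) z" "subderivative (\<lambda>z. ereal (f z)) z w = ereal d"
    and "\<And>k. 0 < t k" "t \<longlonglongrightarrow> 0" "v \<longlonglongrightarrow> w"
  shows "(\<lambda>k. (f (z + t k *\<^sub>R v k) - f z) / t k) \<longlonglongrightarrow> d"
  using semidifferentiable_sequentially[OF assms(1) _ assms(4,5)] assms(2,3)
  by (simp add: diff_quot_real)

section \<open>Graphical derivative and calmness\<close>
lemma graphical_derivativeI:
  assumes "\<And>k. 0 < t k" "t \<longlonglongrightarrow> 0" "v \<longlonglongrightarrow> u" "g \<longlonglongrightarrow> h"
    and "\<And>k. y + t k *\<^sub>R g k \<in> Y (x + t k *\<^sub>R v k)"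
  shows "h \<in> graphical_derivative Y x y u"
  unfolding graphical_derivative_def tangent_cone_def mem_Collect_eq
  by (rule exI[of _ t], rule exI[of _ "\<lambda>k. (v k, g k)"]) (use assms in \<open>auto simp: gph_def intro!: tendsto_Pair\<close>)

definition slopes :: "('a::real_normed_vector \<Rightarrow> 'b::real_normed_vector set) \<Rightarrow> 'a \<Rightarrow> 'b
    \<Rightarrow> real \<times> 'a \<Rightarrow> 'b set" where
  "slopes Y x y = (\<lambda>(t, u'). (\<lambda>z. (z - y) /\<^sub>R t) ` Y (x + t *\<^sub>R u'))"

lemma set_semidifferentiable_iff_slopes:
  "set_semidifferentiable Y x y \<longleftrightarrow>
     (\<forall>u. outer_limit (semi_filter u) (slopes Y x y) = inner_limit (semi_filter u) (slopes Y x y))"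
  by (simp add: set_semidifferentiable_def slopes_def Let_def)

lemma mem_slopes_iff: "t \<noteq> 0 \<Longrightarrow> h \<in> slopes Y x y (t, u) \<longleftrightarrow> y + t *\<^sub>R h \<in> Y (x + t *\<^sub>R u)"
  by (force simp: slopes_def image_iff)

lemma graphical_derivative_subset_outer_limit:
  "graphical_derivative Y x y u \<subseteq> outer_limit (semi_filter u) (slopes Y x y)"
proof
  fix h assume "h \<in> graphical_derivative Y x y u"
  then obtain t v where t: "\<And>k. 0 < t k" "t \<longlonglongrightarrow> 0" and v: "v \<longlonglongrightarrow> (u, h)"
    and tv: "\<And>k. (x, y) + t k *\<^sub>R v k \<in> gph Y"
    by (auto simp: graphical_derivative_def tangent_cone_def)
  have "filterlim (\<lambda>k. (t k, fst (v k))) (semi_filter u) sequentially"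
    by (rule filterlim_semi_filter) (use t tendsto_fst[OF v] in simp_all)
  moreover have "(\<lambda>k. snd (v k)) \<longlonglongrightarrow> h" using tendsto_snd[OF v] by simp
  moreover have "snd (v k) \<in> slopes Y x y (t k, fst (v k))" for k
  proof -
    have "y + t k *\<^sub>R snd (v k) \<in> Y (x + t k *\<^sub>R fst (v k))"
      using tv[of k] by (cases "v k") (simp add: gph_def)
    then show ?thesis using t(1)[of k] by (simp add: mem_slopes_iff)
  qed
  ultimately show "h \<in> outer_limit (semi_filter u) (slopes Y x y)"
    unfolding outer_limit_def by blast
qed

text \<open>Tangent directions are outer limits of slopes, by
  choosing suitable sequences, and since these are also inner limits, the direction can be
  reached along every prescribed sequence.\<close>
lemma graphical_derivative_recovery:
  assumes "set_semidifferentiable Y x y" "h \<in> graphical_derivative Y x y u"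
    and t: "eventually (\<lambda>k. 0 < t k) sequentially" "t \<longlonglongrightarrow> 0" "v \<longlonglongrightarrow> u"
  obtains g where "g \<longlonglongrightarrow> h"
    "eventually (\<lambda>k. y + t k *\<^sub>R g k \<in> Y (x + t k *\<^sub>R v k)) sequentially"
proof -
  have "h \<in> inner_limit (semi_filter u) (slopes Y x y)"
    using assms(1,2) graphical_derivative_subset_outer_limit[of Y x y u] by (auto simp: set_semidifferentiable_iff_slopes)
  then obtain g where g: "g \<longlonglongrightarrow> h" "eventually (\<lambda>k. g k \<in> slopes Y x y (t k, v k)) sequentially"
    using filterlim_semi_filter[OF t] by (auto simp: inner_limit_def)
  show ?thesis
  proof
    show "eventually (\<lambda>k. y + t k *\<^sub>R g k \<in> Y (x + t k *\<^sub>R v k)) sequentially"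
      using g(2) t(1)
    proof eventually_elim
      case (elim k)
      then show ?case by (simp add: mem_slopes_iff)
    qed
  qed (rule g)
qed

lemma zero_mem_graphical_derivative:
  assumes "y \<in> Y x"
  shows "0 \<in> graphical_derivative Y x y 0"
  using LIMSEQ_inverse_real_of_nat assms
  by (intro graphical_derivativeI[of "\<lambda>k. inverse (real (Suc k))" "\<lambda>_. 0" _ "\<lambda>_. 0"]) auto

text \<open>Calmness with its modulus exposed, since the modulus becomes the radius constant.\<close>
definition calm_with :: "('a::real_normed_vector \<Rightarrow> 'b::real_normed_vector set) \<Rightarrow> 'a \<Rightarrow> 'b
    \<Rightarrow> real \<Rightarrow> bool" where
  "calm_with Y x y l \<longleftrightarrow>
     (\<forall>\<^sub>F (x', y') in nhds (x, y). y' \<in> Y x' \<longrightarrow> y' \<in> cball y (l * norm (x' - x)))"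

lemma calm_around_imp_calm_with:
  assumes "calm_around Y x y"
  obtains l where "0 < l" "calm_with Y x y l"
proof -
  obtain l U V where l: "0 < l" and UV: "open U" "x \<in> U" "open V" "y \<in> V"
    and calm: "\<And>x'. x' \<in> U \<Longrightarrow> Y x' \<inter> V \<subseteq> cball y (l * norm (x' - x))"
    using assms unfolding calm_around_def by blast
  have "open (U \<times> V)" "(x, y) \<in> U \<times> V" using UV by (auto intro: open_Times)
  then have "calm_with Y x y l"
    using calm unfolding calm_with_def eventually_nhds by (intro exI[of _ "U \<times> V"]) blast
  with l show ?thesis by (rule that)
qed

lemma calm_with_sequentially:
  assumes "calm_with Y x y l" "X \<longlonglongrightarrow> x" "Z \<longlonglongrightarrow> y" "eventually (\<lambda>k. Z k \<in> Y (X k)) sequentially"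
  shows "eventually (\<lambda>k. Z k \<in> Y (X k) \<inter> cball y (l * norm (X k - x))) sequentially"
  using eventually_compose_filterlim[OF assms(1)[unfolded calm_with_def] tendsto_Pair[OF assms(2,3)]] assms(4)
  by eventually_elim simp

text \<open>It is enough to find points of \<open>Y x'\<close> tending to \<open>y\<close>, since calmness then puts them into the
  small ball. Writing \<open>x' - x\<close> as \<open>t v\<close> with \<open>t = \<parallel>v\<parallel> = \<surd>\<parallel>x' - x\<parallel>\<close> makes the direction \<open>v\<close> tend to \<open>0\<close>,
  so that only the direction \<open>0\<close>, where the graphical derivative is known to contain \<open>0\<close>, is needed.\<close>
lemma localized_values_nonempty:
  assumes "set_semidifferentiable Y x y" "calm_with Y x y l" "y \<in> Y x"
  shows "eventually (\<lambda>x'. Y x' \<inter> cball y (l * norm (x' - x)) \<noteq> {}) (nhds x)"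
proof -
  have "eventually (\<lambda>x'. Y x' \<inter> cball y (l * norm (x' - x)) \<noteq> {}) (at x)"
  proof (rule sequentially_imp_eventually_at, intro allI impI, elim conjE)
    fix X assume X: "\<forall>n. X n \<noteq> x" "X \<longlonglongrightarrow> x"
    define t where "t n = sqrt (norm (X n - x))" for n
    define v where "v n = (X n - x) /\<^sub>R t n" for n
    have t: "0 < t n" for n using X(1) by (simp add: t_def)
    have "(\<lambda>n. norm (X n - x)) \<longlonglongrightarrow> 0"
      using X(2) LIM_zero tendsto_norm_zero by blast
    then have t0: "t \<longlonglongrightarrow> 0"
      using tendsto_real_sqrt[of "\<lambda>n. norm (X n - x)" 0] unfolding t_def by simp
    have "norm (v n) = t n" for n
      using t[of n] by (simp add: v_def t_def real_div_sqrt divide_inverse_commute[symmetric])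
    then have v0: "v \<longlonglongrightarrow> 0" using t0 by (simp add: tendsto_norm_zero_iff[symmetric, of v])
    have tv: "x + t n *\<^sub>R v n = X n" for n using t[of n] by (simp add: v_def)
    obtain g where g: "g \<longlonglongrightarrow> 0" "eventually (\<lambda>k. y + t k *\<^sub>R g k \<in> Y (x + t k *\<^sub>R v k)) sequentially"
      using graphical_derivative_recovery[OF assms(1) zero_mem_graphical_derivative[of y Y x], of t v]
        assms(3) t t0 v0 by auto
    have "(\<lambda>k. y + t k *\<^sub>R g k) \<longlonglongrightarrow> y"
      using tendsto_add[OF tendsto_const tendsto_scaleR[OF t0 g(1)]] by simp
    from calm_with_sequentially[OF assms(2) X(2) this g(2)[unfolded tv]]
    show "eventually (\<lambda>n. Y (X n) \<inter> cball y (l * norm (X n - x)) \<noteq> {}) sequentially"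
      by (rule eventually_mono) blast
  qed
  with assms(3) show ?thesis by (auto simp: eventually_nhds_conv_at)
qed

section \<open>Difference quotients of the localized value function\<close>
lemma near_maximiser:
  fixes F :: "'a \<Rightarrow> real"
  assumes "A \<noteq> {}" "\<And>y. y \<in> A \<Longrightarrow> F y \<le> B" "0 < e"
  shows "\<exists>y r. y \<in> A \<and> (SUP y\<in>A. ereal (F y)) = ereal r \<and> F y \<le> r \<and> r \<le> F y + e"
proof -
  obtain a where a: "a \<in> A" using assms(1) by blast
  have "ereal (F a) \<le> (SUP y\<in>A. ereal (F y))" by (rule SUP_upper[OF a])
  moreover have "(SUP y\<in>A. ereal (F y)) \<le> ereal B" by (rule SUP_least) (simp add: assms(2))
  ultimately obtain r where r: "(SUP y\<in>A. ereal (F y)) = ereal r"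
    by (cases "SUP y\<in>A. ereal (F y)") auto
  then have "ereal (r - e) < (SUP y\<in>A. ereal (F y))" using assms(3) by simp
  then obtain y where y: "y \<in> A" "r - e < F y" by (auto simp: less_SUP_iff)
  moreover have "ereal (F y) \<le> ereal r" unfolding r[symmetric] by (rule SUP_upper[OF y(1)])
  ultimately show ?thesis using r by (intro exI[of _ y] exI[of _ r]) simp
qed

lemma local_value_base: "y \<in> Y x \<Longrightarrow> local_value f Y x y (\<lambda>\<delta>. l * \<delta>) x = ereal (f (x, y))"
proof -
  assume "y \<in> Y x"
  then have "Y x \<inter> cball y (l * norm (x - x)) = {y}" by auto
  then show ?thesis unfolding local_value_def by simp
qed

text \<open>Calmness of \<open>f\<close> bounds its values over the localized feasible set, so near \<open>x\<close> the value function
  is real and can be approximated by feasible points. Exact maximizers need not exist.\<close>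
lemma local_value_near_maximiser:
  fixes f :: "'a::real_normed_vector \<times> 'b::real_normed_vector \<Rightarrow> real"
  assumes f: "semidifferentiable (\<lambda>z. ereal (f z)) (x, y)"
    and Y: "set_semidifferentiable Y x y" "calm_with Y x y l" "y \<in> Y x" and l: "0 < l"
  shows "\<forall>\<^sub>F x' in nhds x. \<forall>e>0. \<exists>y' r. y' \<in> Y x' \<inter> cball y (l * norm (x' - x)) \<and>
           local_value f Y x y (\<lambda>\<delta>. l * \<delta>) x' = ereal r \<and> f (x', y') \<le> r \<and> r \<le> f (x', y') + e"
proof -
  obtain L \<epsilon> where L: "0 < \<epsilon>" "0 < L"
    "\<And>v. norm v < \<epsilon> \<Longrightarrow> \<bar>f ((x, y) + v) - f (x, y)\<bar> \<le> L * norm v"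
    using semidifferentiable_imp_calm[OF f] by metis
  have "((\<lambda>x'. (1 + l) * norm (x' - x)) \<longlongrightarrow> (1 + l) * norm (x - x)) (nhds x)"
    by (intro tendsto_intros filterlim_ident)
  then have "\<forall>\<^sub>F x' in nhds x. (1 + l) * norm (x' - x) < \<epsilon>"
    by (rule order_tendstoD) (use L in simp)
  with localized_values_nonempty[OF Y] show ?thesis
  proof eventually_elim
    case (elim x')
    have bound: "f (x', y') \<le> f (x, y) + L * \<epsilon>" if "y' \<in> Y x' \<inter> cball y (l * norm (x' - x))" for y'
    proof -
      have "norm (x' - x, y' - y) \<le> norm (x' - x) + norm (y' - y)" by (rule norm_Pair_le)
      also have "\<dots> \<le> (1 + l) * norm (x' - x)"
        using that by (simp add: dist_norm norm_minus_commute algebra_simps)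
      finally have n: "norm (x' - x, y' - y) < \<epsilon>" using elim(2) by simp
      from L(3)[OF this] have "f (x', y') - f (x, y) \<le> L * norm (x' - x, y' - y)" by simp
      also have "\<dots> \<le> L * \<epsilon>" using n L(2) by (intro mult_left_mono) auto
      finally show ?thesis by simp
    qed
    show ?case
      unfolding local_value_def
      using near_maximiser[of _ "\<lambda>y'. f (x', y')", OF elim(1) bound] by blast
  qed
qed

text \<open>Near-maximizers \<open>y + t\<^sub>k g\<^sub>k\<close> have bounded slopes \<open>g\<^sub>k\<close>, and a convergent subsequence of slopes
  yields \<open>h\<close>. Besides the limit of the quotients the lemma records that \<open>h\<close> is maximal: any other
  tangent direction is realized by feasible points along the same subsequence, where their values
  stay below the value function.\<close>
lemma local_value_quotient_subsequence:
  fixes f :: "'a::real_normed_vector \<times> 'b::euclidean_space \<Rightarrow> real"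
  assumes f: "semidifferentiable (\<lambda>z. ereal (f z)) (x, y)"
    and d: "\<And>w. subderivative (\<lambda>z. ereal (f z)) (x, y) w = ereal (d w)"
    and Y: "set_semidifferentiable Y x y" "calm_with Y x y l" "y \<in> Y x" and l: "0 < l"
    and t: "\<And>k. 0 < t k" "t \<longlonglongrightarrow> 0" and v: "v \<longlonglongrightarrow> u"
  obtains r h where "strict_mono (r :: nat \<Rightarrow> nat)" "h \<in> graphical_derivative Y x y u"
    "(\<lambda>k. diff_quot (local_value f Y x y (\<lambda>\<delta>. l * \<delta>)) x (t (r k)) (v (r k))) \<longlonglongrightarrow> ereal (d (u, h))"
    "\<And>h'. h' \<in> graphical_derivative Y x y u \<Longrightarrow> d (u, h') \<le> d (u, h)"
proof -
  define V where "V = local_value f Y x y (\<lambda>\<delta>. l * \<delta>)"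
  define X where "X k = x + t k *\<^sub>R v k" for k
  have Xx: "X k - x = t k *\<^sub>R v k" for k by (simp add: X_def)
  have X: "X \<longlonglongrightarrow> x"
    using tendsto_add[OF tendsto_const tendsto_scaleR[OF t(2) v]] by (simp add: X_def[abs_def])
  \<comment> \<open>The pair holds a near-maximizer and the real value of the supremum; the error \<open>t\<^sub>k\<^sup>2\<close>
     becomes \<open>t\<^sub>k\<close> after division.\<close>
  define P where "P k p \<longleftrightarrow> fst p \<in> Y (X k) \<inter> cball y (l * norm (X k - x)) \<and>
      V (X k) = ereal (snd p) \<and> f (X k, fst p) \<le> snd p \<and>
      snd p \<le> f (X k, fst p) + t k * t k" for k and p :: "'b \<times> real"
  have "\<forall>\<^sub>F k in sequentially. \<exists>p. P k p"
    using eventually_compose_filterlim[OF local_value_near_maximiser[OF f Y l] X]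
  proof eventually_elim
    case (elim k)
    then show ?case using t(1)[of k] by (fastforce simp: P_def V_def)
  qed
  then obtain p N where P: "\<And>k. k \<ge> N \<Longrightarrow> P k (p k)"
    unfolding eventually_ex eventually_sequentially by blast
  define g where "g k = (fst (p k) - y) /\<^sub>R t k" for k
  have yg: "y + t k *\<^sub>R g k = fst (p k)" for k using t(1)[of k] by (simp add: g_def)
  have g_le: "norm (g k) \<le> l * norm (v k)" if "k \<ge> N" for k
  proof -
    have "norm (fst (p k) - y) \<le> l * norm (X k - x)"
      using P[OF that] by (simp add: P_def dist_norm norm_minus_commute)
    also have "fst (p k) - y = t k *\<^sub>R g k" using yg[of k] by (simp add: algebra_simps)
    finally have "t k * norm (g k) \<le> t k * (l * norm (v k))"
      using t(1)[of k] by (simp add: Xx mult.left_commute)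
    then show ?thesis using t(1)[of k] by simp
  qed
  obtain B where B: "\<And>k. norm (v k) \<le> B"
    using convergent_imp_bounded[OF v] by (auto simp: bounded_iff)
  have "norm (g (k + N)) \<le> l * B" for k
    using order_trans[OF g_le mult_left_mono[OF B]] l by simp
  then have "bounded (range (\<lambda>k. g (k + N)))" by (auto simp: bounded_iff)
  from bounded_imp_convergent_subsequence[OF this] obtain r' h where
    r': "strict_mono (r' :: nat \<Rightarrow> nat)" and h: "((\<lambda>k. g (k + N)) \<circ> r') \<longlonglongrightarrow> h" by blast
  \<comment> \<open>The near-maximizers are only controlled from index \<open>N\<close> on.\<close>
  define r where "r k = r' k + N" for k
  have r: "strict_mono r" "\<And>k. r k \<ge> N" using r' by (auto simp: r_def strict_mono_def)
  have gr: "(\<lambda>k. g (r k)) \<longlonglongrightarrow> h" using h by (simp add: r_def comp_def)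
  have tr: "(\<lambda>k. t (r k)) \<longlonglongrightarrow> 0" and vr: "(\<lambda>k. v (r k)) \<longlonglongrightarrow> u" and Xr: "(\<lambda>k. X (r k)) \<longlonglongrightarrow> x"
    using LIMSEQ_subseq_LIMSEQ[OF t(2) r(1)] LIMSEQ_subseq_LIMSEQ[OF v r(1)]
      LIMSEQ_subseq_LIMSEQ[OF X r(1)] by (simp_all add: comp_def)
  have hD: "h \<in> graphical_derivative Y x y u"
  proof (rule graphical_derivativeI[OF _ tr vr gr])
    show "y + t (r k) *\<^sub>R g (r k) \<in> Y (x + t (r k) *\<^sub>R v (r k))" for k
      using P[OF r(2)[of k]] by (simp add: yg P_def X_def)
  qed (rule t)
  define q where "q k = (snd (p (r k)) - f (x, y)) / t (r k)" for k
  have dq: "diff_quot V x (t (r k)) (v (r k)) = ereal (q k)" for k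
    using P[OF r(2)[of k]] t(1)[of "r k"]
    by (simp add: diff_quot_def q_def P_def V_def local_value_base[of y Y x, OF Y(3)] flip: X_def)
  have lim: "(\<lambda>k. (f (X (r k), y + t (r k) *\<^sub>R g' k) - f (x, y)) / t (r k)) \<longlonglongrightarrow> d (u, h')"
    if "g' \<longlonglongrightarrow> h'" for g' h'
    using semidifferentiable_real_sequentially[OF f d t(1) tr tendsto_Pair[OF vr that]]
    by (simp add: X_def)
  have q: "q \<longlonglongrightarrow> d (u, h)"
  proof (rule real_tendsto_sandwich)
    let ?a = "\<lambda>k. (f (X (r k), y + t (r k) *\<^sub>R g (r k)) - f (x, y)) / t (r k)"
    show "?a \<longlonglongrightarrow> d (u, h)" by (rule lim[OF gr])
    then show "(\<lambda>k. ?a k + t (r k)) \<longlonglongrightarrow> d (u, h)" using tendsto_add[OF _ tr, of ?a] by simp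
    have "?a k \<le> q k \<and> q k \<le> ?a k + t (r k)" for k
      using P[OF r(2)[of k]] t(1)[of "r k"] by (simp add: yg P_def q_def field_simps)
    then show "\<forall>\<^sub>F k in sequentially. ?a k \<le> q k" "\<forall>\<^sub>F k in sequentially. q k \<le> ?a k + t (r k)"
      by simp_all
  qed
  show ?thesis
  proof (rule that[OF r(1) hD])
    show "(\<lambda>k. diff_quot (local_value f Y x y (\<lambda>\<delta>. l * \<delta>)) x (t (r k)) (v (r k))) \<longlonglongrightarrow> ereal (d (u, h))"
      using q by (simp add: dq flip: V_def)
    fix h' assume "h' \<in> graphical_derivative Y x y u"
    then obtain g' where g': "g' \<longlonglongrightarrow> h'"
      "\<forall>\<^sub>F k in sequentially. y + t (r k) *\<^sub>R g' k \<in> Y (X (r k))"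
      using graphical_derivative_recovery[OF Y(1) _ _ tr vr, of h'] t(1) by (auto simp: X_def)
    have "(\<lambda>k. y + t (r k) *\<^sub>R g' k) \<longlonglongrightarrow> y"
      using tendsto_add[OF tendsto_const tendsto_scaleR[OF tr g'(1)]] by simp
    from calm_with_sequentially[OF Y(2) Xr this g'(2)]
    have "\<forall>\<^sub>F k in sequentially. (f (X (r k), y + t (r k) *\<^sub>R g' k) - f (x, y)) / t (r k) \<le> q k"
    proof eventually_elim
      case (elim k)
      have "ereal (f (X (r k), y + t (r k) *\<^sub>R g' k)) \<le> V (X (r k))"
        unfolding V_def local_value_def by (rule SUP_upper[OF elim])
      then show ?case
        using P[OF r(2)[of k]] t(1)[of "r k"] by (simp add: P_def q_def divide_right_mono)
    qed
    then show "d (u, h') \<le> d (u, h)"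
      by (rule tendsto_le[OF sequentially_bot q lim[OF g'(1)]])
  qed
qed

text \<open>One application of the subsequence lemma produces a maximal \<open>h\<close>. Along any sequence whose
  quotients stayed away from \<open>df(u, h)\<close> the lemma would give a subsequence converging to
  another maximum of \<open>df(u, \<sqdot>)\<close>, that is, to the same number.\<close>
lemma local_value_quotient_limit:
  fixes f :: "'a::real_normed_vector \<times> 'b::euclidean_space \<Rightarrow> real"
  assumes f: "semidifferentiable (\<lambda>z. ereal (f z)) (x, y)"
    and d: "\<And>w. subderivative (\<lambda>z. ereal (f z)) (x, y) w = ereal (d w)"
    and Y: "set_semidifferentiable Y x y" "calm_with Y x y l" "y \<in> Y x" and l: "0 < l"
  obtains h where "h \<in> graphical_derivative Y x y u"
    "\<And>h'. h' \<in> graphical_derivative Y x y u \<Longrightarrow> d (u, h') \<le> d (u, h)"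
    "((\<lambda>(t, u'). diff_quot (local_value f Y x y (\<lambda>\<delta>. l * \<delta>)) x t u') \<longlongrightarrow> ereal (d (u, h)))
       (semi_filter u)"
proof -
  note subsequence = local_value_quotient_subsequence[OF f d Y l]
  define D where "D = (\<lambda>(t, u'). diff_quot (local_value f Y x y (\<lambda>\<delta>. l * \<delta>)) x t u')"
  obtain h where h: "h \<in> graphical_derivative Y x y u"
    "\<And>h'. h' \<in> graphical_derivative Y x y u \<Longrightarrow> d (u, h') \<le> d (u, h)"
    using subsequence[of "\<lambda>k. inverse (real (Suc k))", OF _ LIMSEQ_inverse_real_of_nat tendsto_const]
    by (metis inverse_positive_iff_positive of_nat_0_less_iff zero_less_Suc)
  have lim: "(D \<longlongrightarrow> ereal (d (u, h))) (semi_filter u)"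
  proof (rule tendsto_semi_filter_sequentiallyI, rule ccontr)
    fix t v assume t: "\<And>k. 0 < t k" "t \<longlonglongrightarrow> 0" and v: "v \<longlonglongrightarrow> u"
      and "\<not> (\<lambda>k. D (t k, v k)) \<longlonglongrightarrow> ereal (d (u, h))"
    then obtain S where S: "open S" "ereal (d (u, h)) \<in> S" "\<not> (\<forall>\<^sub>F k in sequentially. D (t k, v k) \<in> S)"
      by (auto simp: tendsto_def)
    then obtain r :: "nat \<Rightarrow> nat" where r: "strict_mono r" "\<And>k. D (t (r k), v (r k)) \<notin> S"
      using not_eventually_sequentiallyD by blast
    have tr: "(\<lambda>k. t (r k)) \<longlonglongrightarrow> 0" and vr: "(\<lambda>k. v (r k)) \<longlonglongrightarrow> u"
      using LIMSEQ_subseq_LIMSEQ[OF t(2) r(1)] LIMSEQ_subseq_LIMSEQ[OF v r(1)] by (simp_all add: comp_def)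
    obtain r' h' where h': "h' \<in> graphical_derivative Y x y u"
      "(\<lambda>k. D (t (r (r' k)), v (r (r' k)))) \<longlonglongrightarrow> ereal (d (u, h'))"
      "d (u, h) \<le> d (u, h')"
    proof (rule subsequence[OF t(1) tr vr], goal_cases)
      case (1 r' h')
      then show ?case using 1(1)[of h' r'] h(1) by (simp add: D_def)
    qed
    from h'(1,3) h(2)[of h'] have "d (u, h') = d (u, h)" by simp
    with h'(2) S(1,2) have "\<forall>\<^sub>F k in sequentially. D (t (r (r' k)), v (r (r' k))) \<in> S"
      by (auto intro: topological_tendstoD)
    with r(2) show False by simp
  qed
  show ?thesis by (rule that[OF h lim[unfolded D_def]])
qed

lemma admissible_radius_calm:
  assumes "set_semidifferentiable Y x y" "calm_with Y x y l" "y \<in> Y x" "0 < l"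
  shows "admissible_radius X Y x y (\<lambda>\<delta>. l * \<delta>)"
proof -
  obtain \<rho> where \<rho>: "0 < \<rho>" "\<And>x'. dist x' x < \<rho> \<Longrightarrow> Y x' \<inter> cball y (l * norm (x' - x)) \<noteq> {}"
    using localized_values_nonempty[OF assms(1-3)] unfolding eventually_nhds_metric by blast
  have "Y x' \<inter> cball y (l * \<delta>) \<noteq> {}" if "\<delta> \<le> \<rho> / 2" "x' \<in> cball x \<delta>" for \<delta> x'
  proof -
    have le: "norm (x' - x) \<le> \<delta>" using that by (simp add: dist_norm norm_minus_commute)
    then have "cball y (l * norm (x' - x)) \<subseteq> cball y (l * \<delta>)"
      using assms(4) by (intro subset_cball) simp
    moreover have "dist x' x < \<rho>" using le that \<rho>(1) by (simp add: dist_norm)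
    ultimately show ?thesis using \<rho>(2)[of x'] by blast
  qed
  then show ?thesis
    unfolding admissible_radius_def using \<rho>(1) by (intro exI[of _ "\<rho> / 2"]) auto
qed

theorem lemma4p1:
  fixes f :: "(real ^ 'n) \<times> (real ^ 'm) \<Rightarrow> real"
    and X :: "(real ^ 'n) set"
    and Y :: "real ^ 'n \<Rightarrow> (real ^ 'm) set"
    and xb :: "real ^ 'n" and yb :: "real ^ 'm"
  assumes "X \<noteq> {}" and "closed X"
    and "\<And>x. x \<in> X \<Longrightarrow> Y x \<noteq> {} \<and> closed (Y x)"
    and "\<And>x. x \<in> X \<Longrightarrow> {y \<in> Y x. \<forall>y'\<in>Y x. f (x, y') \<le> f (x, y)} \<noteq> {}"
    and "(xb, yb) \<in> gph Y"
    and "semidifferentiable (\<lambda>z. ereal (f z)) (xb, yb)"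
    and "set_semidifferentiable Y xb yb"
    and "calm_around Y xb yb"
  shows "\<exists>\<kappa>>0. let \<tau> = (\<lambda>\<delta>. \<kappa> * \<delta>); V = local_value f Y xb yb \<tau> in
           admissible_radius X Y xb yb \<tau> \<and>
           semidifferentiable V xb \<and>
           directionally_differentiable V xb \<and>
           (\<forall>u. is_maximum (dir_deriv V xb u)
                  ((\<lambda>h. subderivative (\<lambda>z. ereal (f z)) (xb, yb) (u, h))
                     ` graphical_derivative Y xb yb u))"
proof -
  have yb: "yb \<in> Y xb" using assms(5) by (simp add: gph_def)
  obtain l where l: "0 < l" "calm_with Y xb yb l"
    using calm_around_imp_calm_with[OF assms(8)] .
  obtain d where d: "\<And>w. subderivative (\<lambda>z. ereal (f z)) (xb, yb) w = ereal (d w)"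
    using semidifferentiable_subderivative_real[OF assms(6)] by blast
  define V where "V = local_value f Y xb yb (\<lambda>\<delta>. l * \<delta>)"
  have "\<exists>h. h \<in> graphical_derivative Y xb yb u \<and>
      (\<forall>h'\<in>graphical_derivative Y xb yb u. d (u, h') \<le> d (u, h)) \<and>
      ((\<lambda>(t, u'). diff_quot V xb t u') \<longlongrightarrow> ereal (d (u, h))) (semi_filter u)" for u
    by (rule local_value_quotient_limit[OF assms(6) d assms(7) l(2) yb l(1), of u]) (auto simp: V_def)
  from choice[OF allI, OF this] obtain H where "\<forall>u. H u \<in> graphical_derivative Y xb yb u \<and>
      (\<forall>h'\<in>graphical_derivative Y xb yb u. d (u, h') \<le> d (u, H u)) \<and>
      ((\<lambda>(t, u'). diff_quot V xb t u') \<longlongrightarrow> ereal (d (u, H u))) (semi_filter u)" ..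
  then have H: "\<And>u. H u \<in> graphical_derivative Y xb yb u"
    "\<And>u h'. h' \<in> graphical_derivative Y xb yb u \<Longrightarrow> d (u, h') \<le> d (u, H u)"
    and full: "\<And>u. ((\<lambda>(t, u'). diff_quot V xb t u') \<longlongrightarrow> ereal (d (u, H u))) (semi_filter u)"
    by blast+
  have V_xb: "\<bar>V xb\<bar> \<noteq> \<infinity>" by (simp add: V_def local_value_base[of yb Y xb, OF yb])
  have radial: "((\<lambda>t. diff_quot V xb t u) \<longlongrightarrow> ereal (d (u, H u))) (at_right 0)" for u
    using filterlim_compose[OF full filterlim_semi_filter[of "\<lambda>t. t" "at_right 0" "\<lambda>_. u" u]]
    by (simp add: eventually_at_right_less)
  have "subderivative V xb u = ereal (d (u, H u))" for u
    unfolding subderivative_def by (rule lim_imp_Liminf[OF semi_filter_neq_bot full])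
  with full V_xb have "semidifferentiable V xb" by (simp add: semidifferentiable_def)
  moreover have "directionally_differentiable V xb"
    using V_xb radial unfolding directionally_differentiable_def by blast
  moreover have "dir_deriv V xb u = ereal (d (u, H u))" for u
    unfolding dir_deriv_def by (rule tendsto_Lim[OF _ radial]) simp
  then have "is_maximum (dir_deriv V xb u)
      ((\<lambda>h. subderivative (\<lambda>z. ereal (f z)) (xb, yb) (u, h)) ` graphical_derivative Y xb yb u)" for u
    using H by (auto simp: is_maximum_def d)
  moreover have "admissible_radius X Y xb yb (\<lambda>\<delta>. l * \<delta>)"
    by (rule admissible_radius_calm[OF assms(7) l(2) yb l(1)])
  ultimately show ?thesis
    using l(1) unfolding Let_def V_def by blast
qed

end
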